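(* Let $I=\{1,\dots,N\}$ and let $(X_i)_{i\in I}$ be random variables with joint law $\Pr$. Suppose that for all distinct $i,j\in I$ one has $\{X_i:X_j\}_*\le\epsilon_{ij}<1$, where $\epsilon_{ij}\ge0$ and $\epsilon_{ji}=\epsilon_{ij}$. For $i\in I$ let $$\tilde1_i=\frac1{\prod_{i<j\le N}(1-\epsilon_{ij}^2)},$$ and for $i<j$ let $$\tilde\epsilon_{ij}=\frac{\epsilon_{ij}}{\prod_{i<j'\le j}(1-\epsilon_{ij'}^2)}.$$ Then the Glauber dynamics associated to $\Pr$ has spectral gap at least $\|M\|^{-2}$, where $\|\cdot\|$ is the operator norm on Euclidean $\mathbb R^N$ and $M$ is the $N\times N$ matrix $$M=\begin{pmatrix}1&-\tilde\epsilon_{12}&\cdots&-\tilde\epsilon_{1N}\\0&\ddots&\ddots&\vdots\\\vdots&\ddots&\ddots&-\tilde\epsilon_{(N-1)N}\\0&\cdots&0&1\end{pmatrix}^{-1}\begin{pmatrix}\tilde1_1&0&\cdots&0\\0&\ddots&\ddots&\vdots\\\vdots&\ddots&\ddots&0\\0&\cdots&0&\tilde1_N\end{pmatrix}$$ (the first factor being the inverse of the upper triangular matrix with unit diagonal and entries $-\tilde\epsilon_{ij}$ for $i<j$).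
   Context: Glauber dynamics: the Markov process on the state space of $(X_i)_{i\in I}$ where each $i\in I$ carries an independent rate-$1$ Poisson clock and, when clock $i$ rings, only $X_i$ is resampled, according to its conditional law under $\Pr$ given $(X_j)_{j\ne i}$. Its energy (Dirichlet form) is $$\mathcal E(f,f)=\sum_{i\in I}\mathbf E\big[\operatorname{Var}(f\,|\,(X_j)_{j\in I\setminus\{i\}})\big],\qquad f\in L^2(\Pr).$$ For $\lambda>0$ the dynamics has spectral gap at least $\lambda$ if $\mathcal E(f,f)\ge\lambda\operatorname{Var}(f)$ for all real square-integrable $f$. Subjective correlation: for $\sigma$-algebras $\mathcal F,\mathcal G,\mathcal H$, $\{\mathcal F:\mathcal G\}_{\mathcal H}$ is the smallest $\epsilon\in[0,1]$ such that $|\mathbf E[fg]|\le\epsilon\operatorname{sd}(f)\operatorname{sd}(g)$ for all real square-integrable $f$ ($\mathcal F\vee\mathcal H$-measurable) and $g$ ($\mathcal G\vee\mathcal H$-measurable) with $\mathbf E[f|\mathcal H]=\mathbf E[g|\mathcal H]=0$ a.s. ($\operatorname{sd}$ is the standard deviation). For the system $(X_k)_{k\in I}$, $$\{X_i:X_j\}_*=\sup_{K\subset I}\{\sigma(X_i):\sigma(X_j)\}_{\sigma((X_k)_{k\in K})}.$$ *)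

theory Defs
  imports "HOL-Probability.Probability"
begin

text \<open>
  Sub-\<open>\<sigma>\<close>-algebras are encoded, as in the library's theory of conditional expectation, by measures
  of which only the space and the measurable sets matter.
\<close>

definition generated_sigma ::
    "'w measure \<Rightarrow> ('i \<Rightarrow> 'b measure) \<Rightarrow> ('i \<Rightarrow> 'w \<Rightarrow> 'b) \<Rightarrow> 'i set \<Rightarrow> 'w measure" where
  "generated_sigma M S X K = vimage_algebra (space M) (\<lambda>\<omega>. \<lambda>k\<in>K. X k \<omega>) (PiM K S)"

definition join_sigma :: "'w measure \<Rightarrow> 'w measure \<Rightarrow> 'w measure" where
  "join_sigma F H = sigma (space F) (sets F \<union> sets H)"

definition std_dev :: "'w measure \<Rightarrow> ('w \<Rightarrow> real) \<Rightarrow> real" where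
  "std_dev M f = sqrt (prob_space.variance M f)"

definition cond_variance :: "'w measure \<Rightarrow> 'w measure \<Rightarrow> ('w \<Rightarrow> real) \<Rightarrow> 'w \<Rightarrow> real" where
  "cond_variance M F f = real_cond_exp M F (\<lambda>x. (f x - real_cond_exp M F f x)\<^sup>2)"

definition square_integrable_wrt :: "'w measure \<Rightarrow> 'w measure \<Rightarrow> ('w \<Rightarrow> real) \<Rightarrow> bool" where
  "square_integrable_wrt M F f \<longleftrightarrow> f \<in> borel_measurable F \<and> integrable M (\<lambda>x. (f x)\<^sup>2)"

text \<open>
  On a probability space the infimum below is a minimum: the set is closed, and it contains 1 by the
  Cauchy-Schwarz inequality (\<open>f\<close> and \<open>g\<close> being centred).
\<close>

definition subjective_corr ::
    "'w measure \<Rightarrow> 'w measure \<Rightarrow> 'w measure \<Rightarrow> 'w measure \<Rightarrow> real" where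
  "subjective_corr M F G H = Inf {e \<in> {0..1}. \<forall>f g.
      square_integrable_wrt M (join_sigma F H) f \<longrightarrow>
      square_integrable_wrt M (join_sigma G H) g \<longrightarrow>
      (AE x in M. real_cond_exp M H f x = 0) \<longrightarrow>
      (AE x in M. real_cond_exp M H g x = 0) \<longrightarrow>
      \<bar>\<integral>x. f x * g x \<partial>M\<bar> \<le> e * std_dev M f * std_dev M g}"

definition subjective_corr_star ::
    "'w measure \<Rightarrow> ('i \<Rightarrow> 'b measure) \<Rightarrow> ('i \<Rightarrow> 'w \<Rightarrow> 'b) \<Rightarrow> 'i set \<Rightarrow> 'i \<Rightarrow> 'i \<Rightarrow> real" where
  "subjective_corr_star M S X I i j =
     (SUP K\<in>Pow I. subjective_corr M
        (vimage_algebra (space M) (X i) (S i))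
        (vimage_algebra (space M) (X j) (S j))
        (generated_sigma M S X K))"

definition joint_law ::
    "'w measure \<Rightarrow> ('i \<Rightarrow> 'b measure) \<Rightarrow> ('i \<Rightarrow> 'w \<Rightarrow> 'b) \<Rightarrow> 'i set \<Rightarrow> ('i \<Rightarrow> 'b) measure" where
  "joint_law M S X I = distr M (PiM I S) (\<lambda>\<omega>. \<lambda>i\<in>I. X i \<omega>)"

text \<open>
  The Glauber dynamics lives on the state space \<open>PiM I S\<close>, carrying the law \<open>P\<close>; there the random
  variables are the coordinate maps.
\<close>

definition glauber_energy ::
    "('i \<Rightarrow> 'b) measure \<Rightarrow> ('i \<Rightarrow> 'b measure) \<Rightarrow> 'i set \<Rightarrow> (('i \<Rightarrow> 'b) \<Rightarrow> real) \<Rightarrow> real" where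
  "glauber_energy P S I f =
     (\<Sum>i\<in>I. \<integral>x. cond_variance P (generated_sigma P S (\<lambda>k y. y k) (I - {i})) f x \<partial>P)"

definition glauber_gap_at_least ::
    "('i \<Rightarrow> 'b) measure \<Rightarrow> ('i \<Rightarrow> 'b measure) \<Rightarrow> 'i set \<Rightarrow> real \<Rightarrow> bool" where
  "glauber_gap_at_least P S I l \<longleftrightarrow> l > 0 \<and>
     (\<forall>f. square_integrable_wrt P (PiM I S) f \<longrightarrow>
          glauber_energy P S I f \<ge> l * prob_space.variance P f)"

text \<open>
  The ordered index set \<open>{1, \<dots>, N}\<close> is an arbitrary finite linearly ordered type \<open>'n\<close>, with
  \<open>N = CARD('n)\<close>; \<open>{i<..}\<close> is then \<open>{j. i < j \<le> N}\<close>.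
\<close>

definition one_tilde :: "('n::{finite,linorder} \<Rightarrow> 'n \<Rightarrow> real) \<Rightarrow> 'n \<Rightarrow> real" where
  "one_tilde eps i = 1 / (\<Prod>j\<in>{i<..}. 1 - (eps i j)\<^sup>2)"

definition eps_tilde :: "('n::{finite,linorder} \<Rightarrow> 'n \<Rightarrow> real) \<Rightarrow> 'n \<Rightarrow> 'n \<Rightarrow> real" where
  "eps_tilde eps i j = eps i j / (\<Prod>j'\<in>{i<..j}. 1 - (eps i j')\<^sup>2)"

definition gap_matrix :: "('n \<Rightarrow> 'n \<Rightarrow> real) \<Rightarrow> real ^ ('n::{finite,linorder}) ^ ('n::{finite,linorder})" where
  "gap_matrix eps =
     matrix_inv (\<chi> i j. if i = j then 1 else if i < j then - eps_tilde eps i j else 0)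
     ** (\<chi> i j. if i = j then one_tilde eps i else 0)"

end

theory Submission imports Defs begin

text \<open>
  Let \<open>f\<^sub>K\<close> be the conditional expectation of \<open>f\<close> given the coordinates in \<open>K\<close>. The variance of \<open>f\<close> is
  the sum of the squared norms of the martingale differences \<open>d\<^sub>j = f\<^bsub>{..j}\<^esub> - f\<^bsub>{..<j}\<^esub>\<close>. For fixed
  \<open>i \<le> j\<close> put \<open>u\<^sub>j = f\<^bsub>{..j}\<^esub> - f\<^bsub>{..j}-{i}\<^esub>\<close>: for \<open>j = i\<close> this is \<open>d\<^sub>i\<close>, and for \<open>j = N\<close> its squared norm is the
  \<open>i\<close>-th term of the energy. If \<open>p\<close> precedes \<open>j\<close>, the correlation hypothesis applied conditionally on
  \<open>{..p} - {i}\<close> yields \<open>(1 - \<epsilon>\<^sub>i\<^sub>j\<^sup>2) \<parallel>u\<^sub>p\<parallel> \<le> \<parallel>u\<^sub>j\<parallel> + \<epsilon>\<^sub>i\<^sub>j \<parallel>d\<^sub>j\<parallel>\<close>. Iterating from \<open>i\<close> to \<open>N\<close> gives a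
  triangular system of inequalities for the norms of the \<open>d\<^sub>i\<close>, whose extremal solution is given by the
  gap matrix.
\<close>

section \<open>Square-integrable functions and conditional expectation\<close>

text \<open>A seminorm on functions rather than on classes modulo null sets. It is meaningful only
  when the square is integrable, since the Bochner integral is 0 otherwise.\<close>

definition L2_norm :: "'a measure \<Rightarrow> ('a \<Rightarrow> real) \<Rightarrow> real" where
  "L2_norm M f = sqrt (\<integral>x. (f x)\<^sup>2 \<partial>M)"

lemma L2_norm_nonneg [simp]: "0 \<le> L2_norm M f"
  by (simp add: L2_norm_def)

lemma L2_norm_power2: "(L2_norm M f)\<^sup>2 = (\<integral>x. (f x)\<^sup>2 \<partial>M)"
  by (simp add: L2_norm_def)

lemma L2_norm_cong_AE:
  assumes "AE x in M. f x = g x" "f \<in> borel_measurable M" "g \<in> borel_measurable M"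
  shows "L2_norm M f = L2_norm M g"
  unfolding L2_norm_def using assms by (auto intro!: arg_cong[where f=sqrt] integral_cong_AE)

lemma square_integrable_mult:
  assumes "square_integrable_wrt M M f" "square_integrable_wrt M M g"
  shows "integrable M (\<lambda>x. f x * g x)"
proof (rule Bochner_Integration.integrable_bound[where f="\<lambda>x. (f x)\<^sup>2 + (g x)\<^sup>2"])
  show "AE x in M. norm (f x * g x) \<le> norm ((f x)\<^sup>2 + (g x)\<^sup>2)"
  proof (rule AE_I2)
    fix x
    have "0 \<le> (f x + g x)\<^sup>2" "0 \<le> (f x - g x)\<^sup>2" "0 \<le> (f x)\<^sup>2" "0 \<le> (g x)\<^sup>2" by simp_all
    then show "norm (f x * g x) \<le> norm ((f x)\<^sup>2 + (g x)\<^sup>2)"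
      unfolding real_norm_def power2_diff power2_sum by linarith
  qed
qed (use assms in \<open>auto simp: square_integrable_wrt_def\<close>)

lemma square_integrable_diff:
  assumes "square_integrable_wrt M M f" "square_integrable_wrt M M g"
  shows "square_integrable_wrt M M (\<lambda>x. f x - g x)"
proof -
  have "integrable M (\<lambda>x. (f x)\<^sup>2 + (g x)\<^sup>2 - 2 * (f x * g x))"
    using assms square_integrable_mult[OF assms]
    by (intro Bochner_Integration.integrable_diff Bochner_Integration.integrable_add
        integrable_mult_right) (auto simp: square_integrable_wrt_def)
  then show ?thesis
    using assms by (auto simp: square_integrable_wrt_def power2_diff mult.assoc)
qed

lemma square_integrable_uminus:
  "square_integrable_wrt M M g \<Longrightarrow> square_integrable_wrt M M (\<lambda>x. - g x)"
  unfolding square_integrable_wrt_def by auto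

text \<open>Cauchy-Schwarz: with \<open>a\<close> and \<open>b\<close> the norms of \<open>f\<close>
  and \<open>g\<close>, expand the nonnegative integral of
  \<open>(b * f x - a * g x)\<^sup>2\<close> and cancel \<open>2 * (a * b)\<close>. If a norm is 0,
  that function vanishes almost everywhere, and so does the product.\<close>

lemma integral_mult_le_L2_norm:
  assumes f: "square_integrable_wrt M M f" and g: "square_integrable_wrt M M g"
  shows "(\<integral>x. f x * g x \<partial>M) \<le> L2_norm M f * L2_norm M g"
proof -
  have [measurable]: "f \<in> borel_measurable M" "g \<in> borel_measurable M"
    and i: "integrable M (\<lambda>x. (f x)\<^sup>2)" "integrable M (\<lambda>x. (g x)\<^sup>2)" "integrable M (\<lambda>x. f x * g x)"
    using f g square_integrable_mult[OF f g] by (auto simp: square_integrable_wrt_def)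
  have z: "(\<integral>x. f x * g x \<partial>M) = 0" if "L2_norm M f = 0 \<or> L2_norm M g = 0"
  proof -
    have "AE x in M. f x * g x = 0"
      using that
    proof
      assume "L2_norm M f = 0"
      then have "AE x in M. f x = 0"
        using integral_nonneg_eq_0_iff_AE[OF i(1)] by (simp add: L2_norm_def)
      then show ?thesis by eventually_elim simp
    next
      assume "L2_norm M g = 0"
      then have "AE x in M. g x = 0"
        using integral_nonneg_eq_0_iff_AE[OF i(2)] by (simp add: L2_norm_def)
      then show ?thesis by eventually_elim simp
    qed
    then show ?thesis using integral_cong_AE[of "\<lambda>x. f x * g x" M "\<lambda>_. 0"] by simp
  qed
  show ?thesis
  proof (cases "L2_norm M f = 0 \<or> L2_norm M g = 0")
    case False
    define a b where "a = L2_norm M f" and "b = L2_norm M g"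
    have ab: "a > 0" "b > 0"
      using False L2_norm_nonneg[of M f] L2_norm_nonneg[of M g] by (auto simp: a_def b_def less_le)
    have "0 \<le> (\<integral>x. (b * f x - a * g x)\<^sup>2 \<partial>M)" by simp
    also have "\<dots> = (\<integral>x. b\<^sup>2 * (f x)\<^sup>2 + a\<^sup>2 * (g x)\<^sup>2 - 2 * a * b * (f x * g x) \<partial>M)"
      by (rule Bochner_Integration.integral_cong) (auto simp: power2_eq_square algebra_simps)
    also have "\<dots> = b\<^sup>2 * a\<^sup>2 + a\<^sup>2 * b\<^sup>2 - 2 * a * b * (\<integral>x. f x * g x \<partial>M)"
      using i by (simp add: a_def b_def L2_norm_power2)
    also have "\<dots> = 2 * (a * b) * (a * b - (\<integral>x. f x * g x \<partial>M))"
      by (simp add: power2_eq_square algebra_simps)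
    finally have "0 \<le> 2 * (a * b) * (a * b - (\<integral>x. f x * g x \<partial>M))" .
    moreover have "0 < 2 * (a * b)" using ab by simp
    ultimately have "0 \<le> a * b - (\<integral>x. f x * g x \<partial>M)" by (metis zero_le_mult_iff not_less)
    then show ?thesis by (simp add: a_def b_def)
  qed (use z in auto)
qed

lemma abs_integral_mult_le_L2_norm:
  assumes f: "square_integrable_wrt M M f" and g: "square_integrable_wrt M M g"
  shows "\<bar>\<integral>x. f x * g x \<partial>M\<bar> \<le> L2_norm M f * L2_norm M g"
proof -
  have "L2_norm M (\<lambda>x. - g x) = L2_norm M g" by (simp add: L2_norm_def)
  then show ?thesis
    using integral_mult_le_L2_norm[OF f g]
      integral_mult_le_L2_norm[OF f square_integrable_uminus[OF g]]
    by (simp add: abs_le_iff)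
qed

section \<open>Conditional expectation as an orthogonal projection\<close>

lemma (in prob_space) integrable_of_square_integrable:
  "square_integrable_wrt M M f \<Longrightarrow> integrable M f"
  unfolding square_integrable_wrt_def by (blast intro: square_integrable_imp_integrable)

lemma (in prob_space) sigma_finite_subalgebra_of_subalgebra: "subalgebra M F \<Longrightarrow> sigma_finite_subalgebra M F"
  using finite_measure_axioms
  by (simp add: finite_measure_subalgebra_is_sigma_finite finite_measure_subalgebra_def
      finite_measure_subalgebra_axioms_def)

text \<open>Conditional expectation preserves the mean, so \<open>f\<close> has mean 0. This links
  \<open>subjective_corr\<close>, stated with standard deviations, to estimates in the norm.\<close>

lemma (in prob_space) std_dev_eq_L2_norm:
  assumes F: "subalgebra M F" and f: "square_integrable_wrt M M f"
    and z: "AE x in M. real_cond_exp M F f x = 0"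
  shows "std_dev M f = L2_norm M f"
proof -
  interpret F: sigma_finite_subalgebra M F by (rule sigma_finite_subalgebra_of_subalgebra[OF F])
  have "expectation f = expectation (real_cond_exp M F f)"
    using F.real_cond_exp_int(2)[OF integrable_of_square_integrable[OF f]] by simp
  also have "\<dots> = 0"
    using integral_cong_AE[of "real_cond_exp M F f" M "\<lambda>_. 0"] z by simp
  finally show ?thesis by (simp add: std_dev_def L2_norm_def)
qed

text \<open>Conditional Jensen inequality for the convex function \<open>x\<^sup>2\<close>.\<close>

lemma (in prob_space) square_integrable_cond_exp:
  assumes F: "subalgebra M F" and f: "square_integrable_wrt M M f"
  shows "square_integrable_wrt M M (real_cond_exp M F f)"
proof -
  interpret F: sigma_finite_subalgebra M F by (rule sigma_finite_subalgebra_of_subalgebra[OF F])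
  have "integrable M (\<lambda>x. (real_cond_exp M F f x)\<^sup>2)"
    using f integrable_of_square_integrable[OF f]
      F.integrable_convex_cond_exp[where I=UNIV and X=f and q="\<lambda>x. x\<^sup>2"]
    by (simp add: square_integrable_wrt_def convex_power2)
  then show ?thesis by (simp add: square_integrable_wrt_def)
qed

lemma (in prob_space) integral_mult_cond_exp:
  assumes F: "subalgebra M F" and f: "square_integrable_wrt M M f"
    and p: "square_integrable_wrt M M p" "p \<in> borel_measurable F"
  shows "(\<integral>x. p x * real_cond_exp M F f x \<partial>M) = (\<integral>x. p x * f x \<partial>M)"
proof -
  interpret F: sigma_finite_subalgebra M F by (rule sigma_finite_subalgebra_of_subalgebra[OF F])
  show ?thesis
    using F.real_cond_exp_intg(2)[OF square_integrable_mult[OF p(1) f] p(2)] f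
    by (simp add: square_integrable_wrt_def)
qed

text \<open>
  With \<open>p = f\<^sub>1 - f\<^sub>0\<close> and \<open>q = f\<^sub>2 - f\<^sub>0\<close>, orthogonality of the projections gives
  \<open>\<parallel>p\<parallel>\<^sup>2 = \<langle>p, f\<^sub>3 - f\<^sub>2\<rangle> + \<langle>p, q\<rangle>\<close> and \<open>\<parallel>q\<parallel>\<^sup>2 = \<langle>q, f\<^sub>3 - f\<^sub>1\<rangle> + \<langle>p, q\<rangle>\<close>.
\<close>

lemma (in prob_space) L2_norm_cond_exp_diff_step:
  assumes F3: "subalgebra M F3"
    and F1: "subalgebra F3 F1" and F2: "subalgebra F3 F2"
    and F01: "subalgebra F1 F0" and F02: "subalgebra F2 F0"
    and f: "square_integrable_wrt M M f"
    and corr: "\<And>p q. square_integrable_wrt M F1 p \<Longrightarrow> square_integrable_wrt M F2 q \<Longrightarrow>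
       AE x in M. real_cond_exp M F0 p x = 0 \<Longrightarrow> AE x in M. real_cond_exp M F0 q x = 0 \<Longrightarrow>
       \<bar>\<integral>x. p x * q x \<partial>M\<bar> \<le> e * L2_norm M p * L2_norm M q"
    and e: "0 \<le> e"
  shows "L2_norm M (\<lambda>x. real_cond_exp M F1 f x - real_cond_exp M F0 f x) * (1 - e\<^sup>2) \<le>
    L2_norm M (\<lambda>x. real_cond_exp M F3 f x - real_cond_exp M F2 f x) +
    e * L2_norm M (\<lambda>x. real_cond_exp M F3 f x - real_cond_exp M F1 f x)"
proof -
  have S: "subalgebra M F1" "subalgebra M F2" "subalgebra M F0"
    using F3 F1 F2 F01 by (auto simp: subalgebra_def)
  define f0 f1 f2 f3 where "f0 = real_cond_exp M F0 f" and "f1 = real_cond_exp M F1 f"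
    and "f2 = real_cond_exp M F2 f" and "f3 = real_cond_exp M F3 f"
  have sq: "square_integrable_wrt M M f0" "square_integrable_wrt M M f1"
    "square_integrable_wrt M M f2" "square_integrable_wrt M M f3"
    using f S F3 by (auto simp: f0_def f1_def f2_def f3_def intro: square_integrable_cond_exp)
  \<comment> \<open>By the tower property, projecting onto \<open>G\<close> and then onto the
    smaller \<open>F0\<close> gives \<open>f0\<close>.\<close>
  have centred: "AE x in M. real_cond_exp M F0 (\<lambda>x. real_cond_exp M G f x - f0 x) x = 0"
    if "subalgebra M G" "subalgebra G F0" for G
  proof -
    interpret F0: sigma_finite_subalgebra M F0 by (rule sigma_finite_subalgebra_of_subalgebra[OF S(3)])
    note i = integrable_of_square_integrable
    have "AE x in M. real_cond_exp M F0 (\<lambda>x. real_cond_exp M G f x - f0 x) x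
        = real_cond_exp M F0 (real_cond_exp M G f) x - real_cond_exp M F0 f0 x"
      by (intro F0.real_cond_exp_diff i sq square_integrable_cond_exp f that)
    moreover have "AE x in M. real_cond_exp M F0 (real_cond_exp M G f) x = f0 x"
      unfolding f0_def by (intro F0.real_cond_exp_nested_subalg i f that)
    moreover have "AE x in M. real_cond_exp M F0 f0 x = f0 x"
      using i[OF sq(1)] by (intro F0.real_cond_exp_F_meas) (auto simp: f0_def)
    ultimately show ?thesis by eventually_elim simp
  qed
  \<comment> \<open>The difference is measurable for \<open>G\<close> and for \<open>F3\<close>, so
    its pairings with the projections of \<open>f\<close> onto \<open>G\<close> and onto
    \<open>F3\<close> both equal its pairing with \<open>f\<close>.\<close>
  have proj: "(\<integral>x. (real_cond_exp M G f x - f0 x) * (real_cond_exp M G f x - f0 x) \<partial>M)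
      = (\<integral>x. (real_cond_exp M G f x - f0 x) * (f3 x - f0 x) \<partial>M)"
    if G: "subalgebra F3 G" "subalgebra G F0" for G
  proof -
    let ?p = "\<lambda>x. real_cond_exp M G f x - f0 x"
    have MG: "subalgebra M G" using F3 G by (auto simp: subalgebra_def)
    have g: "square_integrable_wrt M M (real_cond_exp M G f)"
      by (rule square_integrable_cond_exp[OF MG f])
    note p = square_integrable_diff[OF g sq(1)]
    have "f0 \<in> borel_measurable G"
      unfolding f0_def by (rule measurable_from_subalg[OF G(2)]) simp
    then have pG: "?p \<in> borel_measurable G" by simp
    then have p3: "?p \<in> borel_measurable F3" by (rule measurable_from_subalg[OF G(1)])
    have "(\<integral>x. ?p x * real_cond_exp M G f x \<partial>M) = (\<integral>x. ?p x * f3 x \<partial>M)"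
      unfolding f3_def integral_mult_cond_exp[OF F3 f p p3] integral_mult_cond_exp[OF MG f p pG] ..
    then show ?thesis
      using square_integrable_mult[OF p g] square_integrable_mult[OF p sq(1)]
        square_integrable_mult[OF p sq(4)]
      by (simp add: right_diff_distrib)
  qed
  define p q d u where "p = (\<lambda>x. f1 x - f0 x)" and "q = (\<lambda>x. f2 x - f0 x)"
    and "d = (\<lambda>x. f3 x - f1 x)" and "u = (\<lambda>x. f3 x - f2 x)"
  have sqp: "square_integrable_wrt M M p" "square_integrable_wrt M M q"
      "square_integrable_wrt M M d" "square_integrable_wrt M M u"
    using sq unfolding p_def q_def d_def u_def by (auto intro: square_integrable_diff)
  note i = square_integrable_mult[OF sqp(1) sqp(4)] square_integrable_mult[OF sqp(1) sqp(2)]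
    square_integrable_mult[OF sqp(2) sqp(3)] square_integrable_mult[OF sqp(2) sqp(1)]
  have "(L2_norm M p)\<^sup>2 = (\<integral>x. p x * (f3 x - f0 x) \<partial>M)"
    using proj[OF F1 F01] unfolding L2_norm_power2 by (simp add: power2_eq_square p_def f1_def)
  also have "\<dots> = (\<integral>x. p x * u x + p x * q x \<partial>M)"
    by (simp add: u_def q_def algebra_simps)
  finally have P: "(L2_norm M p)\<^sup>2 = (\<integral>x. p x * u x \<partial>M) + (\<integral>x. p x * q x \<partial>M)"
    using i by simp
  have "(L2_norm M q)\<^sup>2 = (\<integral>x. q x * (f3 x - f0 x) \<partial>M)"
    using proj[OF F2 F02] unfolding L2_norm_power2 by (simp add: power2_eq_square q_def f2_def)
  also have "\<dots> = (\<integral>x. q x * d x + q x * p x \<partial>M)"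
    by (simp add: d_def p_def algebra_simps)
  finally have Q: "(L2_norm M q)\<^sup>2 = (\<integral>x. q x * d x \<partial>M) + (\<integral>x. p x * q x \<partial>M)"
    using i by (simp add: mult.commute)
  have "f0 \<in> borel_measurable F1" "f0 \<in> borel_measurable F2"
    unfolding f0_def using F01 F02 by (auto intro: measurable_from_subalg)
  then have PQ: "\<bar>\<integral>x. p x * q x \<partial>M\<bar> \<le> e * L2_norm M p * L2_norm M q"
    using sqp centred[OF S(1) F01] centred[OF S(2) F02]
    by (intro corr) (auto simp: square_integrable_wrt_def p_def q_def f1_def f2_def)
  define a b where "a = L2_norm M p" and "b = L2_norm M q"
  have ab: "0 \<le> a" "0 \<le> b" by (auto simp: a_def b_def)
  have "b * b \<le> b * (L2_norm M d + e * a)"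
    using Q PQ integral_mult_le_L2_norm[OF sqp(2,3)]
    by (simp add: a_def b_def power2_eq_square algebra_simps)
  \<comment> \<open>One factor \<open>b\<close> cancels; when \<open>b = 0\<close> the right side is
    still nonnegative.\<close>
  then have b: "b \<le> L2_norm M d + e * a"
    using ab e by (cases "b = 0") (auto simp: mult_le_cancel_left)
  have "a * a \<le> a * (L2_norm M u + e * b)"
    using P PQ integral_mult_le_L2_norm[OF sqp(1,4)]
    by (simp add: a_def b_def power2_eq_square algebra_simps)
  then have "a \<le> L2_norm M u + e * b"
    using ab e by (cases "a = 0") (auto simp: mult_le_cancel_left)
  \<comment> \<open>Inserting the bound on \<open>b\<close> into that on \<open>a\<close> produces
    the term \<open>e\<^sup>2 * a\<close>; moved to the left it gives the factor
    \<open>1 - e\<^sup>2\<close>.\<close>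
  also have "\<dots> \<le> L2_norm M u + e * (L2_norm M d + e * a)"
    using b e by (simp add: mult_left_mono)
  finally show ?thesis
    by (simp add: a_def p_def d_def u_def f0_def f1_def f2_def f3_def power2_eq_square algebra_simps)
qed

section \<open>Subjective correlation under the joint law\<close>

lemma space_generated_sigma [simp]: "space (generated_sigma M S X K) = space M"
  by (simp add: generated_sigma_def)

lemma measurable_generated_sigma_component:
  assumes "\<And>k. k \<in> K \<Longrightarrow> X k \<in> measurable M (S k)" "k \<in> K"
  shows "X k \<in> measurable (generated_sigma M S X K) (S k)"
proof -
  have "(\<lambda>\<omega>. \<lambda>k\<in>K. X k \<omega>) \<in> measurable (generated_sigma M S X K) (PiM K S)"
    unfolding generated_sigma_def
    by (rule measurable_vimage_algebra1) (use measurable_space[OF assms(1)] in \<open>auto simp: space_PiM\<close>)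
  then have "(\<lambda>\<omega>. (\<lambda>k\<in>K. X k \<omega>) k) \<in> measurable (generated_sigma M S X K) (S k)"
    by (rule measurable_compose) (rule measurable_component_singleton[OF assms(2)])
  then show ?thesis using assms(2) by simp
qed

lemma measurable_generated_sigmaI:
  assumes "h \<in> space N \<rightarrow> space M" "\<And>k. k \<in> K \<Longrightarrow> (\<lambda>x. X k (h x)) \<in> measurable N (S k)"
  shows "h \<in> measurable N (generated_sigma M S X K)"
  unfolding generated_sigma_def
  using assms by (intro measurable_vimage_algebra2 measurable_restrict)

text \<open>Minimality of the generated sigma-algebra: the identity is measurable from
  \<open>N\<close> into it, and each of its sets is its own preimage under the identity.\<close>

lemma subalgebra_generated_sigma:
  assumes "space N = space M" "\<And>k. k \<in> K \<Longrightarrow> X k \<in> measurable N (S k)"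
  shows "subalgebra N (generated_sigma M S X K)"
proof -
  have id: "(\<lambda>x. x) \<in> measurable N (generated_sigma M S X K)"
    using assms by (intro measurable_generated_sigmaI) auto
  have "A \<in> sets N" if "A \<in> sets (generated_sigma M S X K)" for A
    using measurable_sets[OF id that] sets.sets_into_space[OF that] assms(1)
    by (auto simp: Int_absorb2)
  then show ?thesis using assms(1) by (auto simp: subalgebra_def)
qed

lemma subalgebra_generated_sigma_mono:
  assumes "\<And>k. k \<in> L \<Longrightarrow> X k \<in> measurable M (S k)" "K \<subseteq> L"
  shows "subalgebra (generated_sigma M S X L) (generated_sigma M S X K)"
  using assms by (intro subalgebra_generated_sigma measurable_generated_sigma_component) auto

lemma subalgebra_join_sigma:
  assumes "subalgebra M F" "subalgebra M H"
  shows "subalgebra M (join_sigma F H)" "subalgebra (join_sigma F H) F" "subalgebra (join_sigma F H) H"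
proof -
  have sp: "space F = space M" "space H = space M" and F: "sets F \<subseteq> sets M" and H: "sets H \<subseteq> sets M"
    using assms unfolding subalgebra_def by blast+
  have 1: "sets F \<union> sets H \<subseteq> Pow (space M)"
    using F H sets.space_closed[of M] by blast
  have sps: "space (join_sigma F H) = space M"
    unfolding join_sigma_def sp by (rule space_measure_of[OF 1])
  have 2: "sets (join_sigma F H) = sigma_sets (space M) (sets F \<union> sets H)"
    unfolding join_sigma_def sp by (rule sets_measure_of[OF 1])
  have "sigma_sets (space M) (sets F \<union> sets H) \<subseteq> sets M"
    using F H by (intro sets.sigma_sets_subset Un_least)
  then show "subalgebra M (join_sigma F H)" "subalgebra (join_sigma F H) F"
      "subalgebra (join_sigma F H) H"
    unfolding subalgebra_def 2 sp sps by blast+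
qed

lemma square_integrable_wrt_subalgebra:
  "subalgebra M F \<Longrightarrow> square_integrable_wrt M F f \<Longrightarrow> square_integrable_wrt M M f"
  unfolding square_integrable_wrt_def using measurable_from_subalg by blast

text \<open>For fixed \<open>f\<close> and \<open>g\<close> the bound is linear in the constant, so
  it passes to the infimum; the centring hypotheses turn standard deviations into norms.\<close>

lemma (in prob_space) integral_mult_le_subjective_corr:
  assumes F: "subalgebra M F" and G: "subalgebra M G" and H: "subalgebra M H"
    and f: "square_integrable_wrt M (join_sigma F H) f"
    and g: "square_integrable_wrt M (join_sigma G H) g"
    and f0: "AE x in M. real_cond_exp M H f x = 0"
    and g0: "AE x in M. real_cond_exp M H g x = 0"
  shows "\<bar>\<integral>x. f x * g x \<partial>M\<bar> \<le> subjective_corr M F G H * L2_norm M f * L2_norm M g"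
proof -
  define A where "A = {e \<in> {0..1}. \<forall>f g.
      square_integrable_wrt M (join_sigma F H) f \<longrightarrow>
      square_integrable_wrt M (join_sigma G H) g \<longrightarrow>
      (AE x in M. real_cond_exp M H f x = 0) \<longrightarrow>
      (AE x in M. real_cond_exp M H g x = 0) \<longrightarrow>
      \<bar>\<integral>x. f x * g x \<partial>M\<bar> \<le> e * std_dev M f * std_dev M g}"
  note sqF = square_integrable_wrt_subalgebra[OF subalgebra_join_sigma(1)[OF F H]]
  note sqG = square_integrable_wrt_subalgebra[OF subalgebra_join_sigma(1)[OF G H]]
  \<comment> \<open>Cauchy-Schwarz makes \<open>A\<close> nonempty, without which
    \<open>Inf A\<close> would carry no information.\<close>
  have "1 \<in> A"
    unfolding A_def using abs_integral_mult_le_L2_norm[OF sqF sqG]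
    by (auto simp: std_dev_eq_L2_norm[OF H sqF] std_dev_eq_L2_norm[OF H sqG])
  have le: "\<bar>\<integral>x. f x * g x \<partial>M\<bar> \<le> e * (L2_norm M f * L2_norm M g)" if "e \<in> A" for e
  proof -
    have "\<bar>\<integral>x. f x * g x \<partial>M\<bar> \<le> e * std_dev M f * std_dev M g"
      using that f g f0 g0 unfolding A_def by blast
    then show ?thesis
      using std_dev_eq_L2_norm[OF H sqF[OF f] f0] std_dev_eq_L2_norm[OF H sqG[OF g] g0]
      by (simp add: mult.assoc)
  qed
  \<comment> \<open>Dividing by the product of the norms gives a lower bound of \<open>A\<close>. If
    that product is 0, the element 1 of \<open>A\<close> already forces the integral to
    vanish.\<close>
  have "\<bar>\<integral>x. f x * g x \<partial>M\<bar> \<le> Inf A * (L2_norm M f * L2_norm M g)"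
  proof (cases "L2_norm M f * L2_norm M g = 0")
    case True
    then show ?thesis using le[OF \<open>1 \<in> A\<close>] unfolding True by simp
  next
    case False
    then have pos: "L2_norm M f * L2_norm M g > 0"
      by (metis L2_norm_nonneg less_eq_real_def mult_nonneg_nonneg)
    have "\<bar>\<integral>x. f x * g x \<partial>M\<bar> / (L2_norm M f * L2_norm M g) \<le> Inf A"
      using \<open>1 \<in> A\<close> le pos by (intro cInf_greatest) (auto simp: pos_divide_le_eq)
    then show ?thesis using pos by (simp add: pos_divide_le_eq)
  qed
  then show ?thesis by (simp add: subjective_corr_def A_def mult.assoc)
qed

text \<open>Finiteness of \<open>I\<close> leaves finitely many conditioning sets, so the family is
  bounded above and its supremum dominates each member.\<close>

lemma subjective_corr_le_star:
  assumes "finite I" "K \<subseteq> I"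
  shows "subjective_corr M (vimage_algebra (space M) (X i) (S i)) (vimage_algebra (space M) (X j) (S j))
      (generated_sigma M S X K) \<le> subjective_corr_star M S X I i j"
  unfolding subjective_corr_star_def using assms by (intro cSUP_upper) auto

section \<open>Transfer from the probability space to the state space\<close>

lemma (in prob_space) prob_space_joint_law:
  assumes "\<And>k. k \<in> I \<Longrightarrow> X k \<in> measurable M (S k)"
  shows "prob_space (joint_law M S X I)"
  unfolding joint_law_def using assms by (intro prob_space_distr measurable_restrict)

text \<open>Each event generated by the variables in \<open>K\<close> is the preimage of an event
  generated by the coordinates in \<open>K\<close>. Change of variables equates the two integrals,
  and integrals over such events characterize conditional expectation.\<close>

lemma (in prob_space) real_cond_exp_joint_law_zero:
  fixes X :: "'i \<Rightarrow> 'a \<Rightarrow> 'b" and S :: "'i \<Rightarrow> 'b measure" and I :: "'i set"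
  defines "P \<equiv> joint_law M S X I"
  assumes X: "\<And>k. k \<in> I \<Longrightarrow> X k \<in> measurable M (S k)" and K: "K \<subseteq> I"
    and p: "integrable P p"
    and z: "AE y in P. real_cond_exp P (generated_sigma P S (\<lambda>k y. y k) K) p y = 0"
  shows "AE x in M. real_cond_exp M (generated_sigma M S X K) (\<lambda>\<omega>. p (\<lambda>i\<in>I. X i \<omega>)) x = 0"
proof -
  define T where "T = (\<lambda>\<omega>. \<lambda>i\<in>I. X i \<omega>)"
  have T: "T \<in> measurable M (PiM I S)" unfolding T_def using X by (intro measurable_restrict)
  have Pd: "P = distr M (PiM I S) T" by (simp add: P_def joint_law_def T_def)
  have sP: "space P = space (PiM I S)" by (simp add: Pd)
  interpret P: prob_space P unfolding P_def by (rule prob_space_joint_law[OF X])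
  define H G where "H = generated_sigma M S X K" and "G = generated_sigma P S (\<lambda>k y. y k) K"
  have H: "subalgebra M H" unfolding H_def using X K by (intro subalgebra_generated_sigma) auto
  have G: "subalgebra P G" unfolding G_def using K
    by (intro subalgebra_generated_sigma) (auto simp: Pd)
  interpret H: sigma_finite_subalgebra M H by (rule sigma_finite_subalgebra_of_subalgebra[OF H])
  interpret G: sigma_finite_subalgebra P G by (rule P.sigma_finite_subalgebra_of_subalgebra[OF G])
  have pT: "integrable M (\<lambda>\<omega>. p (T \<omega>))"
    using integrable_distr[OF T] p unfolding Pd by blast
  have "AE x in M. real_cond_exp M H (\<lambda>\<omega>. p (T \<omega>)) x = 0"
  proof (rule H.real_cond_exp_charact)
    fix A assume A: "A \<in> sets H"
    have "(\<lambda>\<omega>. \<lambda>k\<in>K. X k \<omega>) \<in> space M \<rightarrow> space (PiM K S)"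
      using measurable_space[OF X] K by (auto simp: space_PiM)
    then obtain B where B: "B \<in> sets (PiM K S)" and AB: "A = (\<lambda>\<omega>. \<lambda>k\<in>K. X k \<omega>) -` B \<inter> space M"
      using A unfolding H_def generated_sigma_def by (auto simp: sets_vimage_algebra2)
    \<comment> \<open>\<open>C\<close> is the cylinder in the state space with base
      \<open>B\<close>; its preimage under \<open>T\<close> is \<open>A\<close>.\<close>
    define C where "C = (\<lambda>y. \<lambda>k\<in>K. y k) -` B \<inter> space P"
    have C: "C \<in> sets G"
      unfolding C_def G_def generated_sigma_def using B by (rule in_vimage_algebra)
    then have CP: "C \<in> sets P" using G by (auto simp: subalgebra_def)
    have "(\<lambda>k\<in>K. T \<omega> k) = (\<lambda>k\<in>K. X k \<omega>)" for \<omega>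
      using K by (auto simp: T_def restrict_def fun_eq_iff)
    then have ind: "indicator A \<omega> = (indicator C (T \<omega>) :: real)" if "\<omega> \<in> space M" for \<omega>
      using that measurable_space[OF T that] by (auto simp: AB C_def indicator_def sP)
    have "(\<integral>x\<in>A. p (T x) \<partial>M) = (\<integral>x. indicator C (T x) * p (T x) \<partial>M)"
      unfolding set_lebesgue_integral_def by (intro Bochner_Integration.integral_cong) (auto simp: ind)
    also have "\<dots> = (\<integral>y\<in>C. p y \<partial>P)"
      unfolding set_lebesgue_integral_def Pd using p CP T unfolding Pd by (subst integral_distr) auto
    also have "\<dots> = (\<integral>y\<in>C. real_cond_exp P G p y \<partial>P)"
      by (rule G.real_cond_exp_intA[OF p C])
    also have "\<dots> = (\<integral>y. 0 \<partial>P)"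
      unfolding set_lebesgue_integral_def using z CP
      by (intro integral_cong_AE) (auto simp: G_def)
    finally show "(\<integral>x\<in>A. p (T x) \<partial>M) = (\<integral>x\<in>A. 0 \<partial>M)" by simp
  qed (use pT in auto)
  then show ?thesis by (simp add: H_def T_def)
qed

text \<open>Makes a test function of the coordinates in \<open>insert i K\<close>, composed with the
  variables, admissible in \<open>subjective_corr\<close>: coordinate \<open>i\<close> comes from
  the first sigma-algebra, those in \<open>K\<close> from the second.\<close>

lemma (in prob_space) measurable_join_sigma_generated_sigma:
  assumes X: "\<And>k. k \<in> I \<Longrightarrow> X k \<in> measurable M (S k)" and K: "insert i K \<subseteq> I"
  shows "(\<lambda>\<omega>. \<lambda>i\<in>I. X i \<omega>) \<in> measurable
    (join_sigma (vimage_algebra (space M) (X i) (S i)) (generated_sigma M S X K))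
    (generated_sigma (joint_law M S X I) S (\<lambda>k y. y k) (insert i K))"
proof (rule measurable_generated_sigmaI)
  define F H where "F = vimage_algebra (space M) (X i) (S i)" and "H = generated_sigma M S X K"
  have Xi: "X i \<in> measurable M (S i)" using X K by auto
  have F: "subalgebra M F"
    using sets_image_in_sets[OF refl Xi] by (simp add: F_def subalgebra_def)
  have H: "subalgebra M H" unfolding H_def using X K by (intro subalgebra_generated_sigma) auto
  note j = subalgebra_join_sigma[OF F H]
  show "(\<lambda>\<omega>. \<lambda>i\<in>I. X i \<omega>) \<in> space (join_sigma F H) \<rightarrow> space (joint_law M S X I)"
    using j(1) measurable_space[OF X] by (auto simp: joint_law_def subalgebra_def space_PiM)
  fix k assume k: "k \<in> insert i K"
  have "X k \<in> measurable (join_sigma F H) (S k)"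
  proof (cases "k \<in> K")
    case True
    then show ?thesis using X K unfolding H_def
      by (intro measurable_from_subalg[OF j(3)[unfolded H_def]] measurable_generated_sigma_component) auto
  next
    case False
    then have "X k \<in> measurable F (S k)"
      using k measurable_space[OF Xi] unfolding F_def by (auto intro!: measurable_vimage_algebra1)
    then show ?thesis by (rule measurable_from_subalg[OF j(2)])
  qed
  then show "(\<lambda>x. (\<lambda>i\<in>I. X i x) k) \<in> measurable (join_sigma F H) (S k)" using k K by auto
qed

text \<open>The correlation hypothesis speaks of the variables on \<open>M\<close>, the dynamics of
  coordinates under \<open>P\<close>. Composition with \<open>T\<close> preserves integrals, norms,
  measurability and centring, so the same constant serves on the state space.\<close>

lemma (in prob_space) joint_law_corr_bound:
  fixes X :: "'i \<Rightarrow> 'a \<Rightarrow> 'b" and S :: "'i \<Rightarrow> 'b measure" and I :: "'i set"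
  defines "P \<equiv> joint_law M S X I"
  defines "G \<equiv> generated_sigma P S (\<lambda>k y. y k)"
  assumes X: "\<And>k. k \<in> I \<Longrightarrow> X k \<in> measurable M (S k)" and I: "finite I" and K: "K \<subseteq> I" "i \<in> I" "j \<in> I"
    and p: "square_integrable_wrt P (G (insert i K)) p"
    and q: "square_integrable_wrt P (G (insert j K)) q"
    and p0: "AE y in P. real_cond_exp P (G K) p y = 0"
    and q0: "AE y in P. real_cond_exp P (G K) q y = 0"
  shows "\<bar>\<integral>y. p y * q y \<partial>P\<bar> \<le> subjective_corr_star M S X I i j * L2_norm P p * L2_norm P q"
proof -
  define T where "T = (\<lambda>\<omega>. \<lambda>i\<in>I. X i \<omega>)"
  have T: "T \<in> measurable M (PiM I S)" unfolding T_def using X by (intro measurable_restrict)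
  have Pd: "P = distr M (PiM I S) T" by (simp add: P_def joint_law_def T_def)
  interpret P: prob_space P unfolding P_def by (rule prob_space_joint_law[OF X])
  define F H where "F = (\<lambda>i. vimage_algebra (space M) (X i) (S i))" and "H = generated_sigma M S X K"
  have F: "subalgebra M (F k)" if "k \<in> I" for k
    using sets_image_in_sets[OF refl X[OF that]] by (simp add: F_def subalgebra_def)
  have H: "subalgebra M H" unfolding H_def using X K by (intro subalgebra_generated_sigma) auto
  have G: "subalgebra P (G L)" if "L \<subseteq> I" for L unfolding G_def using that
    by (intro subalgebra_generated_sigma) (auto simp: Pd)
  have sq: "square_integrable_wrt M (join_sigma (F k) H) (\<lambda>\<omega>. r (T \<omega>))" "L2_norm M (\<lambda>\<omega>. r (T \<omega>)) = L2_norm P r"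
    "integrable P r" "r \<in> borel_measurable (PiM I S)"
    if r: "square_integrable_wrt P (G (insert k K)) r" and k: "k \<in> I" for k r
  proof -
    have rP: "square_integrable_wrt P P r"
      using square_integrable_wrt_subalgebra[OF G r] k K by simp
    then show "integrable P r" by (rule P.integrable_of_square_integrable)
    show m[measurable]: "r \<in> borel_measurable (PiM I S)"
      using rP by (simp add: square_integrable_wrt_def Pd)
    note T[measurable]
    show "L2_norm M (\<lambda>\<omega>. r (T \<omega>)) = L2_norm P r"
      unfolding L2_norm_def Pd by (simp add: integral_distr)
    have "integrable M (\<lambda>\<omega>. (r (T \<omega>))\<^sup>2)"
      using rP unfolding Pd by (simp add: square_integrable_wrt_def integrable_distr_eq)
    moreover have "(\<lambda>\<omega>. r (T \<omega>)) \<in> borel_measurable (join_sigma (F k) H)"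
    proof -
      have "T \<in> measurable (join_sigma (F k) H) (G (insert k K))"
        unfolding T_def F_def H_def G_def P_def
        by (rule measurable_join_sigma_generated_sigma[OF X]) (use K k in auto)
      moreover have "r \<in> borel_measurable (G (insert k K))"
        using r by (simp add: square_integrable_wrt_def)
      ultimately show ?thesis by (rule measurable_compose)
    qed
    ultimately show "square_integrable_wrt M (join_sigma (F k) H) (\<lambda>\<omega>. r (T \<omega>))"
      by (simp add: square_integrable_wrt_def)
  qed
  have z: "AE x in M. real_cond_exp M H (\<lambda>\<omega>. r (T \<omega>)) x = 0"
    if "integrable P r" "AE y in P. real_cond_exp P (G K) r y = 0" for r
    unfolding H_def T_def
    by (rule real_cond_exp_joint_law_zero[OF X K(1) that[unfolded G_def P_def]])
  note a = sq[OF p K(2)] and b = sq[OF q K(3)]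
  have "\<bar>\<integral>y. p y * q y \<partial>P\<bar> = \<bar>\<integral>x. p (T x) * q (T x) \<partial>M\<bar>"
    unfolding Pd using T a(4) b(4) by (subst integral_distr) auto
  also have "\<dots> \<le> subjective_corr M (F i) (F j) H * L2_norm M (\<lambda>\<omega>. p (T \<omega>)) * L2_norm M (\<lambda>\<omega>. q (T \<omega>))"
    by (rule integral_mult_le_subjective_corr[OF F[OF K(2)] F[OF K(3)] H a(1) b(1)
          z[OF a(3) p0] z[OF b(3) q0]])
  also have "\<dots> = subjective_corr M (F i) (F j) H * L2_norm P p * L2_norm P q"
    by (simp add: a b)
  also have "\<dots> \<le> subjective_corr_star M S X I i j * L2_norm P p * L2_norm P q"
    unfolding F_def H_def by (intro mult_right_mono subjective_corr_le_star I K L2_norm_nonneg)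
  finally show ?thesis .
qed

section \<open>Triangular recursions and the gap matrix\<close>

text \<open>The greatest element below \<open>j\<close>, if there is one, is its immediate
  predecessor; this allows steps along initial segments in an abstract finite order.\<close>

lemma lessThan_eq_atMost_cases:
  fixes j :: "'n::{finite,linorder}"
  obtains "{..<j} = {}" | p where "p < j" "{..<j} = {..p}"
proof (cases "{..<j} = {}")
  case False
  define p where "p = Max {..<j}"
  have "p \<in> {..<j}" unfolding p_def using False by (intro Max_in) auto
  moreover have "x \<le> p" if "x < j" for x
    unfolding p_def using that by (intro Max_ge) auto
  ultimately have "p < j" "{..<j} = {..p}" by auto
  then show ?thesis using that(2) by blast
qed (use that in blast)

text \<open>Passing to a smaller index strictly decreases the cardinality of the initial
  segment.\<close>

lemma finite_linorder_less_induct [case_names less]: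
  fixes j :: "'n::{finite,linorder}"
  assumes "\<And>j. (\<And>p. p < j \<Longrightarrow> Q p) \<Longrightarrow> Q j"
  shows "Q j"
proof (induction j rule: measure_induct_rule[of "\<lambda>j. card {..j}"])
  case (less j)
  show ?case
    by (rule assms, rule less, rule psubset_card_mono) auto
qed

lemma finite_linorder_greater_induct [case_names less]:
  fixes j :: "'n::{finite,linorder}"
  assumes "\<And>j. (\<And>p. j < p \<Longrightarrow> Q p) \<Longrightarrow> Q j"
  shows "Q j"
proof (induction j rule: measure_induct_rule[of "\<lambda>j. card {j..}"])
  case (less j)
  show ?case
    by (rule assms, rule less, rule psubset_card_mono) auto
qed

text \<open>Here \<open>r j\<close> will be \<open>1 - (eps i j)\<^sup>2\<close>, \<open>c j\<close>
  will be \<open>eps i j\<close>, and \<open>v j\<close> the norm of a martingale difference. Each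
  step costs a factor \<open>1 / r j\<close>; the term entering at \<open>k\<close> carries all
  factors up to and including \<open>k\<close>, which is the denominator in
  \<open>eps_tilde\<close>.\<close>

lemma triangular_recursion_bound:
  fixes u v :: "'n::{finite,linorder} \<Rightarrow> real" and r c :: "'n \<Rightarrow> real"
  assumes step: "\<And>p j. i \<le> p \<Longrightarrow> p < j \<Longrightarrow> {..<j} = {..p} \<Longrightarrow> u p * r j \<le> u j + c j * v j"
    and r: "\<And>j. i < j \<Longrightarrow> 0 < r j" and j: "i \<le> j"
  shows "u i \<le> u j / (\<Prod>k\<in>{i<..j}. r k) + (\<Sum>k\<in>{i<..j}. c k / (\<Prod>l\<in>{i<..k}. r l) * v k)"
  using j
proof (induction j rule: finite_linorder_less_induct)
  case (less j)
  show ?case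
  proof (cases "i = j")
    case False
    with less.prems have ij: "i < j" by simp
    obtain p where p: "p < j" "{..<j} = {..p}"
      using ij by (rule_tac lessThan_eq_atMost_cases[of j]) auto
    have ip: "i \<le> p" using p(2) ij by auto
    have eq: "{i<..j} = insert j {i<..p}" using p(2) ij p(1) by force
    have jn: "j \<notin> {i<..p}" using p(1) by auto
    have sum_eq: "(\<Sum>k\<in>{i<..j}. g k) = g j + (\<Sum>k\<in>{i<..p}. g k)" for g :: "'n \<Rightarrow> real"
      unfolding eq using jn by simp
    define R where "R = (\<Prod>k\<in>{i<..p}. r k)"
    have R: "R > 0" unfolding R_def by (intro prod_pos) (auto simp: r)
    have Rj: "(\<Prod>k\<in>{i<..j}. r k) = r j * R" unfolding eq R_def using jn by simp
    have "u p \<le> (u j + c j * v j) / r j"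
      using step[OF ip p] r[OF ij] by (simp add: pos_le_divide_eq)
    \<comment> \<open>The induction hypothesis contains \<open>u p / R\<close>, so the one-step
      bound is divided by \<open>R\<close>.\<close>
    then have "u p / R \<le> (u j + c j * v j) / r j / R"
      using R by (intro divide_right_mono) auto
    also have "\<dots> = u j / (r j * R) + c j / (r j * R) * v j"
      by (simp add: add_divide_distrib)
    finally have 1: "u p / R \<le> u j / (r j * R) + c j / (r j * R) * v j" .
    have "u i \<le> u p / R + (\<Sum>k\<in>{i<..p}. c k / (\<Prod>l\<in>{i<..k}. r l) * v k)"
      using less.IH[OF p(1) ip] by (simp add: R_def)
    also have "\<dots> \<le> u j / (r j * R) + (c j / (r j * R) * v j + (\<Sum>k\<in>{i<..p}. c k / (\<Prod>l\<in>{i<..k}. r l) * v k))"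
      using 1 by simp
    also have "c j / (r j * R) * v j + (\<Sum>k\<in>{i<..p}. c k / (\<Prod>l\<in>{i<..k}. r l) * v k) =
       (\<Sum>k\<in>{i<..j}. c k / (\<Prod>l\<in>{i<..k}. r l) * v k)"
      unfolding sum_eq Rj ..
    finally show ?thesis unfolding Rj .
  qed simp
qed

section \<open>The gap matrix and its operator norm\<close>

lemma invertible_unit_upper_triangular:
  fixes b :: "'n::{finite,linorder} \<Rightarrow> 'n \<Rightarrow> real"
  shows "invertible ((\<chi> i j. if i = j then 1 else if i < j then - b i j else 0)
    :: real ^ ('n::{finite,linorder}) ^ ('n::{finite,linorder}))"
    (is "invertible ?A")
proof -
  have "x = 0" if x: "?A *v x = 0" for x
  proof -
    \<comment> \<open>Back-substitution from the last coordinate: below the diagonal the entries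
      vanish, beyond it the coordinates of \<open>x\<close> do, so row \<open>i\<close> reduces to
      its diagonal term.\<close>
    have "x $ i = 0" for i
    proof (induction i rule: finite_linorder_greater_induct)
      case (less i)
      have "0 = (?A *v x) $ i" using x by simp
      also have "\<dots> = (\<Sum>j\<in>UNIV. (if i = j then 1 else if i < j then - b i j else 0) * x $ j)"
        by (simp add: matrix_vector_mult_def)
      also have "\<dots> = (\<Sum>j\<in>UNIV. if i = j then x $ i else 0)"
        using less by (intro sum.cong) auto
      finally show ?case by simp
    qed
    then show ?thesis by (simp add: vec_eq_iff)
  qed
  then show ?thesis
    unfolding invertible_left_inverse matrix_left_invertible_ker by blast
qed

lemma matrix_inv_mult_right:
  fixes A :: "real^'n^'n"
  assumes "invertible A"
  shows "A ** matrix_inv A = mat 1"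
  using someI_ex[OF assms[unfolded invertible_def]] by (simp add: matrix_inv_def)

lemma one_tilde_pos:
  assumes "\<And>j. i < j \<Longrightarrow> 0 \<le> eps i j \<and> eps i j < 1"
  shows "0 < one_tilde eps i"
  unfolding one_tilde_def using assms
  by (intro divide_pos_pos prod_pos) (auto simp: abs_square_less_1)

lemma eps_tilde_nonneg:
  assumes "\<And>j. i < j \<Longrightarrow> 0 \<le> eps i j \<and> eps i j < 1" "i < j"
  shows "0 \<le> eps_tilde eps i j"
  unfolding eps_tilde_def using assms
  by (intro divide_nonneg_pos prod_pos) (auto simp: abs_square_less_1)

text \<open>With \<open>A\<close> the triangular and \<open>D\<close> the diagonal factor, the
  product \<open>w\<close> satisfies \<open>A *v w = D *v a\<close>; this is its row
  \<open>i\<close>. Thus \<open>w\<close> solves the triangular system with equality.\<close>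

lemma gap_matrix_mult_component:
  fixes eps :: "'n::{finite,linorder} \<Rightarrow> 'n \<Rightarrow> real"
  shows "(gap_matrix eps *v a) $ i =
    (\<Sum>j\<in>{i<..}. eps_tilde eps i j * (gap_matrix eps *v a) $ j) + one_tilde eps i * a $ i"
proof -
  define A :: "((real, 'n) vec, 'n) vec" where "A = (\<chi> i j. if i = j then 1 else if i < j then - eps_tilde eps i j else 0)"
  define D :: "((real, 'n) vec, 'n) vec" where "D = (\<chi> i j. if i = j then one_tilde eps i else 0)"
  define w where "w = gap_matrix eps *v a"
  have w: "w = matrix_inv A *v (D *v a)"
    by (simp add: w_def gap_matrix_def A_def D_def matrix_vector_mul_assoc)
  have "A *v w = (A ** matrix_inv A) *v (D *v a)"
    unfolding w by (simp add: matrix_vector_mul_assoc matrix_mul_assoc)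
  also have "\<dots> = D *v a"
    unfolding A_def by (subst matrix_inv_mult_right[OF invertible_unit_upper_triangular]) simp
  finally have "(A *v w) $ i = (D *v a) $ i" by simp
  moreover have "(D *v a) $ i = one_tilde eps i * a $ i"
    by (simp add: D_def matrix_vector_mult_def if_distrib[of "\<lambda>x. x * _"] cong: if_cong)
  moreover have "(A *v w) $ i = w $ i - (\<Sum>j\<in>{i<..}. eps_tilde eps i j * w $ j)"
  proof -
    have "(A *v w) $ i = (\<Sum>j\<in>UNIV. (if i = j then w $ j else 0) - (if j \<in> {i<..} then eps_tilde eps i j * w $ j else 0))"
      unfolding A_def matrix_vector_mult_def by (auto intro!: sum.cong)
    then show ?thesis by (simp add: sum_subtractf sum.If_cases greaterThan_def)
  qed
  ultimately show ?thesis by (simp add: w_def)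
qed

text \<open>A positive gap constant requires a nonzero norm, because \<open>0 powi (-2)\<close> is
  0. If the image of the all-ones vector were 0, the row equation would force
  \<open>one_tilde\<close> to vanish.\<close>

lemma onorm_gap_matrix_pos:
  fixes eps :: "'n::{finite,linorder} \<Rightarrow> 'n \<Rightarrow> real"
  assumes "\<And>i j. i < j \<Longrightarrow> 0 \<le> eps i j \<and> eps i j < 1"
  shows "0 < onorm (\<lambda>v. gap_matrix eps *v v)"
proof -
  have "gap_matrix eps *v (\<chi> i. 1) \<noteq> 0"
  proof
    fix i :: 'n
    assume "gap_matrix eps *v (\<chi> i. 1) = 0"
    then have "one_tilde eps i = 0"
      using gap_matrix_mult_component[of eps "\<chi> i. 1" i] by simp
    then show False using one_tilde_pos[of i eps] assms by auto
  qed
  then show ?thesis by (subst onorm_pos_lt) auto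
qed

text \<open>Comparison principle: the coefficients \<open>eps_tilde\<close> are nonnegative, so
  bounds on later components pass to earlier ones, and the solution with equality is the
  largest.\<close>

lemma le_gap_matrix_mult:
  fixes eps :: "'n::{finite,linorder} \<Rightarrow> 'n \<Rightarrow> real" and a v :: "real ^ ('n::{finite,linorder})"
  assumes "\<And>i j. i < j \<Longrightarrow> 0 \<le> eps i j \<and> eps i j < 1"
    and v: "\<And>i. v $ i \<le> (\<Sum>j\<in>{i<..}. eps_tilde eps i j * v $ j) + one_tilde eps i * a $ i"
  shows "v $ i \<le> (gap_matrix eps *v a) $ i"
proof (induction i rule: finite_linorder_greater_induct)
  case (less i)
  have "(\<Sum>j\<in>{i<..}. eps_tilde eps i j * v $ j) \<le> (\<Sum>j\<in>{i<..}. eps_tilde eps i j * (gap_matrix eps *v a) $ j)"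
    using less assms by (intro sum_mono mult_left_mono eps_tilde_nonneg) auto
  then show ?case using v[of i] gap_matrix_mult_component[of eps a i] by linarith
qed

text \<open>Nonnegativity of \<open>v\<close> turns the componentwise comparison into one of
  absolute values, hence of Euclidean norms.\<close>

lemma norm_le_onorm_gap_matrix:
  fixes eps :: "'n::{finite,linorder} \<Rightarrow> 'n \<Rightarrow> real" and a v :: "real ^ ('n::{finite,linorder})"
  assumes "\<And>i j. i < j \<Longrightarrow> 0 \<le> eps i j \<and> eps i j < 1"
    and "\<And>i. v $ i \<le> (\<Sum>j\<in>{i<..}. eps_tilde eps i j * v $ j) + one_tilde eps i * a $ i"
    and "\<And>i. 0 \<le> v $ i"
  shows "norm v \<le> onorm (\<lambda>v. gap_matrix eps *v v) * norm a"
proof -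
  have "norm v \<le> norm (gap_matrix eps *v a)"
  proof (rule norm_le_componentwise_cart)
    fix i
    have "v $ i \<le> (gap_matrix eps *v a) $ i" by (rule le_gap_matrix_mult[OF assms(1,2)])
    with assms(3)[of i] show "norm (v $ i) \<le> norm ((gap_matrix eps *v a) $ i)" by simp
  qed
  also have "\<dots> \<le> onorm (\<lambda>v. gap_matrix eps *v v) * norm a"
    by (rule onorm[OF matrix_vector_mul_bounded_linear])
  finally show ?thesis .
qed

section \<open>Martingale differences\<close>

text \<open>The quantity \<open>u j\<close> measures the influence of coordinate \<open>i\<close>
  once the coordinates up to \<open>j\<close> are known. It starts at \<open>v i f\<close> and ends,
  at the last index, with the norm on the right; each step is one use of the correlation
  bound.\<close>

lemma (in prob_space) martingale_difference_recursion:
  fixes G :: "'n::{finite,linorder} set \<Rightarrow> 'a measure" and eps :: "'n \<Rightarrow> 'n \<Rightarrow> real"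
  defines "v \<equiv> \<lambda>i f. L2_norm M (\<lambda>x. real_cond_exp M (G {..i}) f x - real_cond_exp M (G {..<i}) f x)"
  assumes sub: "\<And>K. subalgebra M (G K)" and mono: "\<And>K L. K \<subseteq> L \<Longrightarrow> subalgebra (G L) (G K)"
    and corr: "\<And>i j K p q. i < j \<Longrightarrow>
       square_integrable_wrt M (G (insert i K)) p \<Longrightarrow> square_integrable_wrt M (G (insert j K)) q \<Longrightarrow>
       AE x in M. real_cond_exp M (G K) p x = 0 \<Longrightarrow> AE x in M. real_cond_exp M (G K) q x = 0 \<Longrightarrow>
       \<bar>\<integral>x. p x * q x \<partial>M\<bar> \<le> eps i j * L2_norm M p * L2_norm M q"
    and eps: "\<And>i j. i < j \<Longrightarrow> 0 \<le> eps i j \<and> eps i j < 1"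
    and f: "square_integrable_wrt M M f"
  shows "v i f \<le> (\<Sum>j\<in>{i<..}. eps_tilde eps i j * v j f) + one_tilde eps i *
    L2_norm M (\<lambda>x. real_cond_exp M (G UNIV) f x - real_cond_exp M (G (UNIV - {i})) f x)"
proof -
  define u where "u = (\<lambda>j. L2_norm M (\<lambda>x. real_cond_exp M (G {..j}) f x - real_cond_exp M (G ({..j} - {i})) f x))"
  define N where "N = Max (UNIV :: 'n set)"
  have N: "j \<le> N" for j unfolding N_def by (intro Max_ge) auto
  have top: "{..N} = UNIV" "{i<..N} = {i<..}" using N by auto
  have "u i \<le> u N / (\<Prod>k\<in>{i<..N}. 1 - (eps i k)\<^sup>2)
      + (\<Sum>k\<in>{i<..N}. eps i k / (\<Prod>l\<in>{i<..k}. 1 - (eps i l)\<^sup>2) * v k f)"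
  proof (rule triangular_recursion_bound)
    fix p j assume p: "i \<le> p" "p < j" "{..<j} = {..p}"
    \<comment> \<open>Conditioning on \<open>K\<close> puts \<open>i\<close> and \<open>j\<close> in
      the roles of the two correlated variables: adjoining \<open>i\<close> gives
      \<open>{..p}\<close>, adjoining \<open>j\<close> gives \<open>{..j} - {i}\<close>, and both
      lie in \<open>{..j}\<close>.\<close>
    define K where "K = {..p} - {i}"
    have K: "insert i K = {..p}" "insert j K = {..j} - {i}"
      using p unfolding K_def by (auto simp flip: p(3))
    have "u p * (1 - (eps i j)\<^sup>2) \<le> u j + eps i j * L2_norm M (\<lambda>x. real_cond_exp M (G {..j}) f x - real_cond_exp M (G {..p}) f x)"
      unfolding u_def K_def[symmetric] K(2)[symmetric]
    proof (rule L2_norm_cond_exp_diff_step[OF sub mono mono mono mono f])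
      show "{..p} \<subseteq> {..j}" "insert j K \<subseteq> {..j}" "K \<subseteq> {..p}" "K \<subseteq> insert j K"
        using p K by (auto simp: K_def)
      show "0 \<le> eps i j" using eps p by auto
    next
      fix r q
      assume "square_integrable_wrt M (G {..p}) r" "square_integrable_wrt M (G (insert j K)) q"
        "AE x in M. real_cond_exp M (G K) r x = 0" "AE x in M. real_cond_exp M (G K) q x = 0"
      then show "\<bar>\<integral>x. r x * q x \<partial>M\<bar> \<le> eps i j * L2_norm M r * L2_norm M q"
        using p by (intro corr[of i j K]) (auto simp: K)
    qed
    then show "u p * (1 - (eps i j)\<^sup>2) \<le> u j + eps i j * v j f"
      by (simp add: v_def p(3))
  next
    fix j assume "i < j"
    then show "0 < 1 - (eps i j)\<^sup>2" using eps[of i j] by (simp add: abs_square_less_1)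
  qed (rule N)
  \<comment> \<open>This identifies the starting value \<open>u i\<close> with
    \<open>v i f\<close>.\<close>
  moreover have "{..i} - {i} = {..<i}" by auto
  ultimately show ?thesis
    by (simp add: u_def v_def top eps_tilde_def one_tilde_def add.commute)
qed

text \<open>The increment between nested projections is orthogonal to the coarser one:
  \<open>f0\<close> has the same pairing with \<open>f1\<close>, with \<open>f\<close> and with
  itself.\<close>

lemma (in prob_space) cond_exp_pythagoras:
  assumes F1: "subalgebra M F1" and F0: "subalgebra F1 F0" and f: "square_integrable_wrt M M f"
  shows "(\<integral>x. (real_cond_exp M F1 f x)\<^sup>2 \<partial>M) = (\<integral>x. (real_cond_exp M F0 f x)\<^sup>2 \<partial>M) +
    (L2_norm M (\<lambda>x. real_cond_exp M F1 f x - real_cond_exp M F0 f x))\<^sup>2"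
proof -
  have MF0: "subalgebra M F0" using F1 F0 unfolding subalgebra_def by auto
  define f0 f1 where "f0 = real_cond_exp M F0 f" and "f1 = real_cond_exp M F1 f"
  have sq: "square_integrable_wrt M M f0" "square_integrable_wrt M M f1"
    unfolding f0_def f1_def using square_integrable_cond_exp F1 MF0 f by blast+
  have m0: "f0 \<in> borel_measurable F0" by (simp add: f0_def)
  have m1: "f0 \<in> borel_measurable F1" by (rule measurable_from_subalg[OF F0 m0])
  have 1: "(\<integral>x. f0 x * f1 x \<partial>M) = (\<integral>x. f0 x * f0 x \<partial>M)"
    using integral_mult_cond_exp[OF F1 f sq(1) m1] integral_mult_cond_exp[OF MF0 f sq(1) m0]
    by (simp add: f0_def f1_def)
  have i: "integrable M (\<lambda>x. f1 x * f1 x)" "integrable M (\<lambda>x. f0 x * f0 x)" "integrable M (\<lambda>x. f0 x * f1 x)"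
    using sq square_integrable_mult by blast+
  have "(\<integral>x. (f1 x - f0 x)\<^sup>2 \<partial>M) = (\<integral>x. f1 x * f1 x + f0 x * f0 x - 2 * (f0 x * f1 x) \<partial>M)"
    by (intro Bochner_Integration.integral_cong) (auto simp: power2_eq_square algebra_simps)
  also have "\<dots> = (\<integral>x. f1 x * f1 x \<partial>M) - (\<integral>x. f0 x * f0 x \<partial>M)"
    using i 1 by simp
  finally show ?thesis
    unfolding L2_norm_power2 by (simp add: power2_eq_square f0_def f1_def)
qed

text \<open>Pythagoras telescoped along initial segments; at the first index the preceding segment
  is empty, which supplies the base term.\<close>

lemma (in prob_space) cond_exp_martingale_decomposition:
  fixes G :: "'n::{finite,linorder} set \<Rightarrow> 'a measure"
  assumes sub: "\<And>K. subalgebra M (G K)" and mono: "\<And>K L. K \<subseteq> L \<Longrightarrow> subalgebra (G L) (G K)"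
    and f: "square_integrable_wrt M M f"
  shows "(\<integral>x. (real_cond_exp M (G {..j}) f x)\<^sup>2 \<partial>M) = (\<integral>x. (real_cond_exp M (G {}) f x)\<^sup>2 \<partial>M) +
    (\<Sum>k\<in>{..j}. (L2_norm M (\<lambda>x. real_cond_exp M (G {..k}) f x - real_cond_exp M (G {..<k}) f x))\<^sup>2)"
proof (induction j rule: finite_linorder_less_induct)
  case (less j)
  have "{..j} = insert j {..<j}" by auto
  moreover have "(\<integral>x. (real_cond_exp M (G {..<j}) f x)\<^sup>2 \<partial>M) = (\<integral>x. (real_cond_exp M (G {}) f x)\<^sup>2 \<partial>M) +
    (\<Sum>k\<in>{..<j}. (L2_norm M (\<lambda>x. real_cond_exp M (G {..k}) f x - real_cond_exp M (G {..<k}) f x))\<^sup>2)"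
    by (cases rule: lessThan_eq_atMost_cases[of j]) (use less in auto)
  moreover have "subalgebra (G {..j}) (G {..<j})" by (rule mono) auto
  ultimately show ?case
    using cond_exp_pythagoras[OF sub _ f, of "{..j}" "G {..<j}"] by simp
qed

text \<open>A level set of the conditional expectation is measurable and nonempty, hence the whole
  space. The function is therefore constant everywhere, and the constant is its preserved
  mean.\<close>

lemma (in prob_space) real_cond_exp_trivial:
  assumes F: "subalgebra M F" and triv: "sets F \<subseteq> {{}, space M}" and f: "integrable M f" and x: "x \<in> space M"
  shows "real_cond_exp M F f x = expectation f"
proof -
  interpret F: sigma_finite_subalgebra M F by (rule sigma_finite_subalgebra_of_subalgebra[OF F])
  define g where "g = real_cond_exp M F f"
  have "g -` {g x} \<inter> space F \<in> sets F"
    unfolding g_def by (intro measurable_sets[OF borel_measurable_cond_exp]) auto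
  moreover have "x \<in> g -` {g x} \<inter> space F" using F x by (simp add: subalgebra_def)
  ultimately have "g -` {g x} \<inter> space F = space M" using triv by blast
  then have "g y = g x" if "y \<in> space M" for y using that by blast
  then have "expectation g = expectation (\<lambda>_. g x)" by (intro Bochner_Integration.integral_cong) auto
  then have "expectation g = g x" by (simp add: prob_space)
  then show ?thesis using F.real_cond_exp_int(2)[OF f] by (simp add: g_def)
qed

text \<open>The product over the empty index set is a single point, so the generating map is
  constant.\<close>

lemma sets_generated_sigma_empty: "sets (generated_sigma M S X {}) \<subseteq> {{}, space M}"
proof -
  have "sets (generated_sigma M S X {}) \<subseteq> sets (sigma (space M) {})"
    unfolding generated_sigma_def by (intro sets_image_in_sets) (simp_all add: restrict_def space_PiM)
  also have "sets (sigma (space M) {}) = {{}, space M}"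
    by (simp add: sigma_sets_empty_eq)
  finally show ?thesis .
qed

text \<open>The outer conditional expectation disappears on integration. This identifies each term
  of the energy with a squared distance to a projection.\<close>

lemma (in prob_space) integral_cond_variance:
  assumes F: "subalgebra M F" and f: "square_integrable_wrt M M f"
  shows "(\<integral>x. cond_variance M F f x \<partial>M) = (L2_norm M (\<lambda>x. f x - real_cond_exp M F f x))\<^sup>2"
proof -
  interpret F: sigma_finite_subalgebra M F by (rule sigma_finite_subalgebra_of_subalgebra[OF F])
  show ?thesis
    using square_integrable_diff[OF f square_integrable_cond_exp[OF F f]]
    unfolding cond_variance_def L2_norm_power2 square_integrable_wrt_def
    by (intro F.real_cond_exp_int(2)) auto
qed

section \<open>The spectral gap from the variance decomposition\<close>

theorem theorem4p2p5:
  fixes M :: "'w measure"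
    and S :: "'n::{finite,linorder} \<Rightarrow> 'b measure"
    and X :: "'n \<Rightarrow> 'w \<Rightarrow> 'b"
    and eps :: "'n \<Rightarrow> 'n \<Rightarrow> real"
  assumes "prob_space M"
    and "\<And>i. X i \<in> measurable M (S i)"
    and "\<And>i j. i \<noteq> j \<Longrightarrow> subjective_corr_star M S X UNIV i j \<le> eps i j"
    and "\<And>i j. i \<noteq> j \<Longrightarrow> eps i j < 1"
    and "\<And>i j. i \<noteq> j \<Longrightarrow> eps i j \<ge> 0"
    and "\<And>i j. i \<noteq> j \<Longrightarrow> eps j i = eps i j"
  shows "glauber_gap_at_least (joint_law M S X UNIV) S UNIV
           (onorm (\<lambda>v. gap_matrix eps *v v) powi (-2))"
proof -
  interpret prob_space M by fact
  note X = assms(2)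
  define P where "P = joint_law M S X UNIV"
  interpret P: prob_space P unfolding P_def by (rule prob_space_joint_law[OF X])
  have sP: "sets P = sets (PiM UNIV S)" by (simp add: P_def joint_law_def)
  define G where "G = generated_sigma P S (\<lambda>k y. y k)"
  have coord: "(\<lambda>y. y k) \<in> measurable P (S k)" for k
    unfolding measurable_cong_sets[OF sP refl] by simp
  have sub: "subalgebra P (G K)" for K
    unfolding G_def by (intro subalgebra_generated_sigma coord refl)
  have mono: "subalgebra (G L) (G K)" if "K \<subseteq> L" for K L
    unfolding G_def by (intro subalgebra_generated_sigma_mono coord that)
  have eps: "0 \<le> eps i j \<and> eps i j < 1" if "i < j" for i j
    using assms(4,5)[of i j] that by auto
  have corr: "\<bar>\<integral>y. p y * q y \<partial>P\<bar> \<le> eps i j * L2_norm P p * L2_norm P q"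
    if "i < j" "square_integrable_wrt P (G (insert i K)) p" "square_integrable_wrt P (G (insert j K)) q"
      "AE y in P. real_cond_exp P (G K) p y = 0" "AE y in P. real_cond_exp P (G K) q y = 0"
    for i j K p q
  proof -
    have "\<bar>\<integral>y. p y * q y \<partial>P\<bar> \<le> subjective_corr_star M S X UNIV i j * L2_norm P p * L2_norm P q"
      unfolding P_def
      by (rule joint_law_corr_bound[OF X _ _ _ _ that(2-5)[unfolded G_def P_def]]) simp_all
    also have "\<dots> \<le> eps i j * L2_norm P p * L2_norm P q"
      using assms(3)[of i j] that(1) by (intro mult_right_mono L2_norm_nonneg) auto
    finally show ?thesis .
  qed
  define C where "C = onorm (\<lambda>v. gap_matrix eps *v v)"
  have C: "0 < C" unfolding C_def by (rule onorm_gap_matrix_pos[OF eps])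
  have "C powi (-2) * P.variance f \<le> glauber_energy P S UNIV f"
    if f': "square_integrable_wrt P (PiM UNIV S) f" for f
  proof -
    have f: "square_integrable_wrt P P f"
      using f' unfolding square_integrable_wrt_def measurable_cong_sets[OF sP refl] .
    note fi = P.integrable_of_square_integrable[OF f]
    have f2: "integrable P (\<lambda>x. (f x)\<^sup>2)" using f by (simp add: square_integrable_wrt_def)
    define d where "d = (\<lambda>i. L2_norm P (\<lambda>x. real_cond_exp P (G {..i}) f x - real_cond_exp P (G {..<i}) f x))"
    define a where "a = (\<lambda>i. L2_norm P (\<lambda>x. f x - real_cond_exp P (G (UNIV - {i})) f x))"
    have "(\<lambda>y. \<lambda>k\<in>UNIV. y k) \<in> measurable (G UNIV) (PiM UNIV S)"
      unfolding G_def
      by (intro measurable_restrict measurable_generated_sigma_component[where X="\<lambda>k y. y k"] coord)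
    then have id: "(\<lambda>y. y) \<in> measurable (G UNIV) (PiM UNIV S)"
      unfolding restrict_UNIV .
    have "f \<in> borel_measurable (PiM UNIV S)" using f' by (simp add: square_integrable_wrt_def)
    then have fG: "f \<in> borel_measurable (G UNIV)" by (rule measurable_compose[OF id])
    interpret U: sigma_finite_subalgebra P "G UNIV" by (rule P.sigma_finite_subalgebra_of_subalgebra[OF sub])
    \<comment> \<open>All coordinates together generate the full sigma-algebra of the state space,
      so the last member of the martingale is \<open>f\<close> itself.\<close>
    have EU: "AE x in P. real_cond_exp P (G UNIV) f x = f x"
      by (rule U.real_cond_exp_F_meas[OF fi fG])
    have a: "L2_norm P (\<lambda>x. real_cond_exp P (G UNIV) f x - real_cond_exp P (G (UNIV - {i})) f x) = a i" for i
      unfolding a_def using EU fi by (intro L2_norm_cong_AE) auto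
    have "d i \<le> (\<Sum>j\<in>{i<..}. eps_tilde eps i j * d j) + one_tilde eps i * a i" for i
      unfolding d_def a[symmetric]
      by (rule P.martingale_difference_recursion[where G=G, OF sub mono corr eps f])
    then have "norm (\<chi> i. d i) \<le> C * norm (\<chi> i. a i)"
      unfolding C_def by (intro norm_le_onorm_gap_matrix eps) (auto simp: d_def)
    then have "(norm (\<chi> i. d i))\<^sup>2 \<le> (C * norm (\<chi> i. a i))\<^sup>2"
      by (rule power_mono) simp
    then have main: "(\<Sum>i\<in>UNIV. (d i)\<^sup>2) \<le> C\<^sup>2 * (\<Sum>i\<in>UNIV. (a i)\<^sup>2)"
      by (simp add: norm_vec_def L2_set_def power_mult_distrib sum_nonneg)
    have N: "{..Max (UNIV :: 'n set)} = UNIV" by auto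
    \<comment> \<open>No coordinates generate the trivial sigma-algebra, so the base term is the
      squared mean; subtracting it from the second moment leaves the variance.\<close>
    have "(\<integral>x. (real_cond_exp P (G {}) f x)\<^sup>2 \<partial>P) = (\<integral>x. (P.expectation f)\<^sup>2 \<partial>P)"
      using P.real_cond_exp_trivial[OF sub _ fi, of "{}"] sets_generated_sigma_empty[of P S "\<lambda>k y. y k"]
      by (intro Bochner_Integration.integral_cong) (auto simp: G_def)
    then have E0: "(\<integral>x. (real_cond_exp P (G {}) f x)\<^sup>2 \<partial>P) = (P.expectation f)\<^sup>2"
      by (simp add: P.prob_space)
    have EN: "(\<integral>x. (real_cond_exp P (G UNIV) f x)\<^sup>2 \<partial>P) = P.expectation (\<lambda>x. (f x)\<^sup>2)"
    proof (rule integral_cong_AE)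
      show "AE x in P. (real_cond_exp P (G UNIV) f x)\<^sup>2 = (f x)\<^sup>2"
        using EU by eventually_elim simp
    qed (use fi in simp_all)
    have "P.variance f = (\<Sum>i\<in>UNIV. (d i)\<^sup>2)"
      using P.cond_exp_martingale_decomposition[where G=G, OF sub mono f, where j="Max UNIV"]
      unfolding N E0 EN P.variance_eq[OF fi f2] d_def by simp
    moreover have "glauber_energy P S UNIV f = (\<Sum>i\<in>UNIV. (a i)\<^sup>2)"
      unfolding glauber_energy_def G_def[symmetric] a_def
      by (simp add: P.integral_cond_variance[OF sub f])
    \<comment> \<open>\<open>C powi (-2)\<close> is the reciprocal of \<open>C\<^sup>2\<close>, so
      \<open>main\<close> is divided by the positive \<open>C\<^sup>2\<close>.\<close>
    ultimately show ?thesis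
      using main C by (simp add: power_int_minus field_simps)
  qed
  then show ?thesis
    using C by (simp add: glauber_gap_at_least_def P_def C_def)
qed

end
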